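(* Let $n\ge1$. The map $u\mapsto\mathbb{R}_{\ge0}\,\vec v(u)$ is a bijection from the disjoint union $\mathfrak N\sqcup\mathfrak B$ to the set of extreme rays of $\mathrm{I}(\mathfrak{sl}_n,V\oplus\bigwedge^2)$.
   Context: Let $\mathfrak h=\mathbb{R}^n$ with coordinates $x_1,\dots,x_n$, $\mathfrak h_s=\{x_1+\cdots+x_n=0\}$, $W=\{x_1\ge\cdots\ge x_n\}$, $W_s=W\cap\mathfrak h_s$. $\mathrm{I}(\mathfrak{sl}_n,V\oplus\bigwedge^2)$ is the arrangement in $\mathfrak h_s$ of the kernels of the weights $x_i$ ($1\le i\le n$) and $x_i+x_j$ ($1\le i<j\le n$) restricted to $\mathfrak h_s$, considered only inside $W_s$. A chamber is the closure of a connected component of the set of points in the interior of $W_s$ (relative to $\mathfrak h_s$) at which no weight not identically zero on $\mathfrak h_s$ vanishes. A face is a face, in the sense of convex polyhedral cones, of a chamber (faces contained in the walls $x_i=x_{i+1}$ count). An extreme ray is a face that is a half-line. $\mathbb{E}^*_n=\{(a,b)\in\mathbb{N}^2: 1\le a+b\le n\}$ with the componentwise order $(a,b)\le(c,d)\iff a\le c,\ b\le d$; the signature of $(a,b)$ is $\sigma(a,b)=a-b$. For $p=(a,b)\in\mathbb{E}^*_n$, $$\vec v(p)=(\underbrace{1,\dots,1}_{a},\underbrace{0,\dots,0}_{n-a-b},\underbrace{-1,\dots,-1}_{b})\in\mathfrak h .$$ $\mathfrak N$ is the set of $p\in\mathbb{E}^*_n$ with $\sigma(p)=0$, and $\mathfrak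 B=\{(p,q)\in(\mathbb{E}^*_n)^2: p<q,\ \sigma(p)\sigma(q)<0\}$. For $(p,q)\in\mathfrak B$, $\vec v(p,q)=|\sigma(q)|\,\vec v(p)+|\sigma(p)|\,\vec v(q)\in\mathfrak h_s$. *)

theory Defs
  imports "HOL-Analysis.Analysis"
begin

text \<open>
  The ambient space \<open>\<real>\<^sup>n\<close> is \<open>real ^ 'n\<close> for a finite linearly ordered index type \<open>'n\<close>,
  with \<open>n = CARD('n)\<close>; the coordinates \<open>x\<^sub>1, \<dots>, x\<^sub>n\<close> are the components listed in increasing
  order of their index. Such types exist for every \<open>n \<ge> 1\<close>.
\<close>

definition coord_pos :: "'n::{finite,linorder} \<Rightarrow> nat"
  \<comment> \<open>the number in \<open>{1..n}\<close> of an index\<close>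
  where "coord_pos i = card {j. j \<le> i}"

definition h_s :: "(real ^ 'n::{finite,linorder}) set"
  where "h_s = {x. (\<Sum>i\<in>UNIV. x $ i) = 0}"

definition weyl :: "(real ^ 'n::{finite,linorder}) set"
  where "weyl = {x. \<forall>i j. i \<le> j \<longrightarrow> x $ j \<le> x $ i}"

definition weyl_s :: "(real ^ 'n::{finite,linorder}) set"
  where "weyl_s = weyl \<inter> h_s"

definition weights :: "(real ^ 'n::{finite,linorder} \<Rightarrow> real) set"
  where "weights = range (\<lambda>i x. x $ i) \<union> {(\<lambda>x. x $ i + x $ j) | i j. i < j}"

text \<open>
  Weights vanishing identically on \<open>h_s\<close> (\<open>x\<^sub>1\<close> for \<open>n = 1\<close>, \<open>x\<^sub>1 + x\<^sub>2\<close> for \<open>n = 2\<close>)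
  define no hyperplane of \<open>h_s\<close> and are ignored.
\<close>

definition regular_points :: "(real ^ 'n::{finite,linorder}) set"
  where "regular_points =
    {x \<in> (top_of_set h_s) interior_of weyl_s.
       \<forall>w\<in>weights. (\<exists>y\<in>h_s. w y \<noteq> 0) \<longrightarrow> w x \<noteq> 0}"

definition chambers :: "(real ^ 'n::{finite,linorder}) set set"
  where "chambers = closure ` components regular_points"

definition arrangement_faces :: "(real ^ 'n::{finite,linorder}) set set"
  where "arrangement_faces = {F. \<exists>C\<in>chambers. F face_of C}"

definition half_line :: "'a::real_vector set \<Rightarrow> bool"
  where "half_line S \<longleftrightarrow> (\<exists>p d. d \<noteq> 0 \<and> S = {p + t *\<^sub>R d | t. t \<ge> 0})"

definition extreme_rays :: "(real ^ 'n::{finite,linorder}) set set"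
  where "extreme_rays = {F \<in> arrangement_faces. half_line F}"

text \<open>
  The order on pairs of natural numbers is the componentwise one, \<open>less_eq_prod_def\<close> and
  \<open>less_prod_def\<close> of \<open>Product_Order\<close>.
\<close>

definition estar :: "nat \<Rightarrow> (nat \<times> nat) set"
  where "estar n = {(a, b). 1 \<le> a + b \<and> a + b \<le> n}"

definition signature :: "nat \<times> nat \<Rightarrow> int"
  where "signature p = int (fst p) - int (snd p)"

definition null_points :: "nat \<Rightarrow> (nat \<times> nat) set"
  where "null_points n = {p \<in> estar n. signature p = 0}"

definition balanced_pairs :: "nat \<Rightarrow> ((nat \<times> nat) \<times> (nat \<times> nat)) set"
  where "balanced_pairs n =
    {(p, q). p \<in> estar n \<and> q \<in> estar n \<and> p < q \<and> signature p * signature q < 0}"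

definition vec_point :: "nat \<times> nat \<Rightarrow> real ^ 'n::{finite,linorder}"
  where "vec_point p = (\<chi> i. if coord_pos i \<le> fst p then 1
                             else if CARD('n) < coord_pos i + snd p then - 1
                             else 0)"

definition vec_pair :: "(nat \<times> nat) \<times> (nat \<times> nat) \<Rightarrow> real ^ 'n::{finite,linorder}"
  where "vec_pair pq = (case pq of (p, q) \<Rightarrow>
      of_int \<bar>signature q\<bar> *\<^sub>R vec_point p + of_int \<bar>signature p\<bar> *\<^sub>R vec_point q)"

definition vec_of ::
  "(nat \<times> nat) + ((nat \<times> nat) \<times> (nat \<times> nat)) \<Rightarrow> real ^ 'n::{finite,linorder}"
  where "vec_of = case_sum vec_point vec_pair"

definition ray_of :: "'a::real_vector \<Rightarrow> 'a set"
  where "ray_of v = {t *\<^sub>R v | t. t \<ge> 0}"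

end

theory Submission
  imports Defs
begin

text \<open>
  The idea is to describe a chamber by signs, a face of a chamber by a domination relation between
  vectors, and the points of the Weyl chamber by their level sets.

  Adjoin the roots \<open>x\<^sub>i - x\<^sub>j\<close> to the weights. The component of a regular point \<open>y\<close> is the set of points
  of \<open>h_s\<close> at which every one of these linear forms has the sign that it has at \<open>y\<close>: this set is
  convex, and a sign cannot change along a connected set of regular points. Hence the chambers are
  the pointed cones \<open>form_cone y = {z \<in> h_s. \<forall>w. w y * w z \<ge> 0}\<close> (\<open>chambers_eq\<close>). A half-line that is
  a face of a pointed cone starts at the apex, so extreme rays are rays \<open>\<real>\<^sub>\<ge>\<^sub>0 d\<close>. As regular points
  exist, any point of the Weyl chamber can be moved slightly to a regular one without changing a
  nonzero sign, so it lies in some chamber (\<open>exists_chamber_containing\<close>).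

  For \<open>x\<close> in the Weyl chamber and \<open>t > 0\<close> let \<open>level x t\<close> count the coordinates that are \<open>\<ge> t\<close> and those
  that are \<open>\<le> -t\<close>. The \<open>i\<close>-th coordinate of \<open>vec_point (level x t)\<close> is an odd monotone function
  of \<open>x\<^sub>i\<close> (\<open>vec_point_level\<close>). Therefore each form is on this vector zero or of the same sign as on \<open>x\<close>,
  and zero where it is zero on \<open>x\<close>. The layer cake formula says \<open>x = \<integral> vec_point (level x t) dt\<close>, and
  summing coordinates gives \<open>\<Sum>x\<^sub>i = \<integral> signature (level x t) dt\<close>.

  Every extreme ray is in the image. If \<open>d \<noteq> 0\<close> lies in \<open>h_s\<close>, the integral of the signatures of
  its levels vanishes, so a nonzero level has signature zero or two levels have opposite
  signatures; these two are comparable since levels decrease in \<open>t\<close>. In both cases this yields an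
  index \<open>u\<close> whose vector \<open>e = vec_of u\<close> is subordinate to \<open>d\<close> (\<open>subordinate_vec_of\<close>). Both \<open>e\<close>
  and \<open>d - r e\<close>, for small \<open>r > 0\<close>, then lie in every chamber that contains \<open>d\<close>; if \<open>d\<close> spans a
  face, \<open>e\<close> must be a multiple of \<open>d\<close> (\<open>ray_face_eq_vec_of\<close>).

  Every vector in the image spans an extreme ray. If two points of a chamber have a convex
  combination on the ray of \<open>v = vec_of u\<close>, all forms that vanish on \<open>v\<close> vanish on both. A vector
  with this property has the same pattern of equal, opposite and zero coordinates as \<open>v\<close>, hence is a
  combination of the two vectors \<open>vec_point\<close> that make up \<open>v\<close>; the equation of \<open>h_s\<close> then leaves only
  multiples of \<open>v\<close> (\<open>rigid_vec_of\<close>).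

  Finally the map is injective because the set of nonzero levels depends only on the ray, and for
  \<open>vec_of u\<close> it is the chain of one or two points from which \<open>u\<close> is formed (\<open>levels_vec_of\<close>).
\<close>

section \<open>Coordinates and linear forms\<close>

definition root_forms :: "(real ^ 'n::{finite,linorder} \<Rightarrow> real) set"
  where "root_forms = {(\<lambda>x. x $ i - x $ j) | i j. i < j}"

definition forms :: "(real ^ 'n::{finite,linorder} \<Rightarrow> real) set"
  where "forms = root_forms \<union> weights"

lemma diff_in_forms: "i < j \<Longrightarrow> (\<lambda>x. x $ i - x $ j) \<in> forms"
  by (auto simp: forms_def root_forms_def)

lemma coordinate_in_forms: "(\<lambda>x. x $ i) \<in> forms"
  by (auto simp: forms_def weights_def)

lemma sum_in_forms: "i < j \<Longrightarrow> (\<lambda>x. x $ i + x $ j) \<in> forms"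
  by (auto simp: forms_def weights_def)

lemma forms_cases [consumes 1, case_names diff coordinate sum]:
  assumes "w \<in> forms"
  obtains i j where "i < j" "w = (\<lambda>x. x $ i - x $ j)"
  | i where "w = (\<lambda>x. x $ i)"
  | i j where "i < j" "w = (\<lambda>x. x $ i + x $ j)"
  using assms unfolding forms_def root_forms_def weights_def by blast

lemma finite_forms: "finite (forms :: (real ^ 'n::{finite,linorder} \<Rightarrow> real) set)"
proof -
  have "(forms :: ((real, 'n) vec \<Rightarrow> real) set)
      \<subseteq> range (\<lambda>(i, j) x. x $ i - x $ j) \<union> range (\<lambda>i x. x $ i) \<union> range (\<lambda>(i, j) x. x $ i + x $ j)"
    by (auto elim!: forms_cases simp: image_iff)
  then show ?thesis
    by (rule finite_subset) auto
qed

lemma linear_forms: "w \<in> forms \<Longrightarrow> linear w"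
  by (elim forms_cases; simp add: linear_iff algebra_simps)

lemma continuous_on_forms: "w \<in> forms \<Longrightarrow> continuous_on S w"
  using linear_forms linear_continuous_on linear_conv_bounded_linear by blast

lemma subspace_h_s: "subspace h_s"
  by (auto simp: subspace_def h_s_def sum.distrib simp flip: sum_distrib_left)

lemmas h_s_closed = subspace_add[OF subspace_h_s] subspace_diff[OF subspace_h_s] subspace_scale[OF subspace_h_s]

text \<open>
  The counting arguments on \<open>vec_point\<close> reduce to counting in \<open>{1..n}\<close> through this bijection.
\<close>

lemma bij_coord_pos:
  "bij_betw coord_pos (UNIV :: 'n::{finite,linorder} set) {1..CARD('n)}"
proof -
  have "strict_mono (coord_pos :: 'n \<Rightarrow> nat)"
    unfolding strict_mono_def coord_pos_def by (intro allI impI psubset_card_mono) (auto simp: psubset_eq set_eq_iff intro: less_imp_le dest: leD)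
  then have inj: "inj (coord_pos :: 'n \<Rightarrow> nat)"
    by (rule strict_mono_imp_inj_on)
  have "1 \<le> coord_pos i \<and> coord_pos i \<le> CARD('n)" for i :: 'n
  proof
    have "{j. j \<le> i} \<noteq> {}" by blast
    then show "1 \<le> coord_pos i" by (simp add: coord_pos_def Suc_le_eq card_gt_0_iff)
    show "coord_pos i \<le> CARD('n)" unfolding coord_pos_def by (intro card_mono) auto
  qed
  then have "range (coord_pos :: 'n \<Rightarrow> nat) \<subseteq> {1..CARD('n)}" by auto
  moreover have "card (range (coord_pos :: 'n \<Rightarrow> nat)) = card {1..CARD('n)}"
    using inj by (simp add: card_image)
  ultimately have "range (coord_pos :: 'n \<Rightarrow> nat) = {1..CARD('n)}"
    by (metis card_subset_eq finite_atLeastAtMost)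
  with inj show ?thesis by (simp add: bij_betw_def)
qed

lemma coord_pos_mono: "i \<le> j \<Longrightarrow> coord_pos i \<le> coord_pos (j :: 'n::{finite,linorder})"
  unfolding coord_pos_def by (rule card_mono) auto

lemma coord_pos_bounds: "1 \<le> coord_pos i" "coord_pos (i :: 'n::{finite,linorder}) \<le> CARD('n)"
  using bij_betwE[OF bij_coord_pos] by auto

lemma card_coord_pos:
  assumes "A \<subseteq> {1..CARD('n)}"
  shows "card {i :: 'n::{finite,linorder}. coord_pos i \<in> A} = card A"
proof -
  have inj: "inj (coord_pos :: 'n \<Rightarrow> nat)" and ran: "range (coord_pos :: 'n \<Rightarrow> nat) = {1..CARD('n)}"
    using bij_coord_pos[where 'n='n] by (auto simp only: bij_betw_def)
  have "card (coord_pos -` A :: 'n set) = card A"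
    using inj assms by (intro card_vimage_inj) (simp_all add: ran)
  then show ?thesis by (simp add: vimage_def)
qed

lemma card_initial_indices:
  assumes "a \<le> CARD('n)"
  shows "card {i :: 'n::{finite,linorder}. coord_pos i \<le> a} = a"
proof -
  have "{i :: 'n. coord_pos i \<le> a} = {i. coord_pos i \<in> {1..a}}"
    using coord_pos_bounds(1) by auto
  then show ?thesis using card_coord_pos[of "{1..a}", where 'n='n] assms by simp
qed

lemma card_final_indices:
  assumes "b \<le> CARD('n)"
  shows "card {i :: 'n::{finite,linorder}. CARD('n) < coord_pos i + b} = b"
proof -
  have "{i :: 'n. CARD('n) < coord_pos i + b} = {i. coord_pos i \<in> {Suc (CARD('n) - b)..CARD('n)}}"
  proof (intro Collect_cong)
    fix i :: 'n
    show "CARD('n) < coord_pos i + b \<longleftrightarrow> coord_pos i \<in> {Suc (CARD('n) - b)..CARD('n)}"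
      using coord_pos_bounds[of i] assms by auto
  qed
  then show ?thesis using card_coord_pos[of "{Suc (CARD('n) - b)..CARD('n)}", where 'n='n] assms
    by simp
qed

section \<open>Perturbation\<close>

text \<open>
  For small \<open>e > 0\<close> the sign of \<open>f w + e * g w\<close> is decided lexicographically by \<open>f w\<close> and \<open>g w\<close>, and
  finitely many \<open>w\<close> admit a common \<open>e\<close>. Below \<open>f\<close> and \<open>g\<close> evaluate linear forms at two points.
\<close>

lemma perturb_finite:
  fixes f g :: "'w \<Rightarrow> real"
  assumes "finite A"
  shows "\<exists>e>0. \<forall>w\<in>A. sgn (f w + e * g w) = (if f w \<noteq> 0 then sgn (f w) else sgn (g w))"
proof -
  have "\<forall>\<^sub>F e in at_right 0. sgn (f w + e * g w) = (if f w \<noteq> 0 then sgn (f w) else sgn (g w))" for w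
  proof (cases "f w = 0")
    case True
    have "\<forall>\<^sub>F e::real in at_right 0. 0 < e" by (rule eventually_at_right_less)
    then show ?thesis by (rule eventually_mono) (simp add: True sgn_mult)
  next
    case False
    have lim: "((\<lambda>e. f w + e * g w) \<longlongrightarrow> f w) (at_right 0)"
      by (auto intro!: tendsto_eq_intros)
    show ?thesis
    proof (cases "f w > 0")
      case True
      from order_tendstoD(1)[OF lim True] show ?thesis
        by (rule eventually_mono) (use True in simp)
    next
      case neg: False
      with False have "f w < 0" by simp
      from order_tendstoD(2)[OF lim this] show ?thesis
        by (rule eventually_mono) (use \<open>f w < 0\<close> in simp)
    qed
  qed
  then have "\<forall>\<^sub>F e in at_right 0. \<forall>w\<in>A. sgn (f w + e * g w) = (if f w \<noteq> 0 then sgn (f w) else sgn (g w))"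
    using assms by (simp add: eventually_ball_finite)
  moreover have "\<forall>\<^sub>F e::real in at_right 0. 0 < e" by (rule eventually_at_right_less)
  ultimately have "\<forall>\<^sub>F e in at_right 0. 0 < e \<and> (\<forall>w\<in>A. sgn (f w + e * g w) = (if f w \<noteq> 0 then sgn (f w) else sgn (g w)))"
    by (rule eventually_conj[rotated])
  then show ?thesis
    using eventually_happens[of _ "at_right (0::real)"] trivial_limit_at_right_real by blast
qed

text \<open>
  A subspace is not a finite union of proper hyperplanes of it. A point that misses all but one
  of them is moved slightly off the last one.
\<close>

lemma generic_point_in_subspace:
  fixes S :: "'a::real_vector set"
  assumes "finite A" and "\<forall>w\<in>A. linear (w :: 'a \<Rightarrow> real)" and S: "subspace S"
  shows "\<exists>g\<in>S. \<forall>w\<in>A. (\<exists>y\<in>S. w y \<noteq> 0) \<longrightarrow> w g \<noteq> 0"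
  using assms(1,2)
proof (induction A rule: finite_induct)
  case empty
  then show ?case using S subspace_0 by blast
next
  case (insert w0 A)
  then obtain g where g: "g \<in> S" "\<forall>w\<in>A. (\<exists>y\<in>S. w y \<noteq> 0) \<longrightarrow> w g \<noteq> 0"
    by auto
  show ?case
  proof (cases "(\<exists>y\<in>S. w0 y \<noteq> 0) \<and> w0 g = 0")
    case True
    then obtain y where y: "y \<in> S" "w0 y \<noteq> 0" and "w0 g = 0" by auto
    obtain e where e: "e > 0" "\<forall>w\<in>A. sgn (w g + e * w y) = (if w g \<noteq> 0 then sgn (w g) else sgn (w y))"
      using perturb_finite[OF insert.hyps(1), of "\<lambda>w. w g" "\<lambda>w. w y"] by blast
    have lin: "w (g + e *\<^sub>R y) = w g + e * w y" if "w \<in> insert w0 A" for w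
    proof -
      have "linear w" using insert.prems that by blast
      then show ?thesis by (simp add: linear_add linear_scale)
    qed
    show ?thesis
    proof (rule bexI[of _ "g + e *\<^sub>R y"], intro ballI impI)
      show "g + e *\<^sub>R y \<in> S" using S g y by (simp add: subspace_add subspace_scale)
      fix w assume w: "w \<in> insert w0 A" and nontriv: "\<exists>y\<in>S. w y \<noteq> 0"
      show "w (g + e *\<^sub>R y) \<noteq> 0"
      proof (cases "w = w0")
        case True
        with \<open>w0 g = 0\<close> y e w show ?thesis by (simp add: lin)
      next
        case False
        with w have "w \<in> A" by simp
        with g nontriv have "w g \<noteq> 0" by blast
        with e \<open>w \<in> A\<close> have "sgn (w g + e * w y) \<noteq> 0" by (simp add: sgn_eq_0_iff)
        with w show ?thesis by (auto simp: lin)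
      qed
    qed
  next
    case False
    then show ?thesis using g by (intro bexI[of _ g]) auto
  qed
qed

text \<open>
  Adding to \<open>v\<close> a small multiple of a generic point makes every nontrivial form nonzero and keeps
  the signs that are already nonzero at \<open>v\<close>.
\<close>

lemma generic_point_near:
  fixes S :: "'a::real_vector set"
  assumes fin: "finite A" and lin: "\<forall>w\<in>A. linear (w :: 'a \<Rightarrow> real)" and S: "subspace S" and "v \<in> S"
  shows "\<exists>g\<in>S. \<forall>w\<in>A. (w v \<noteq> 0 \<longrightarrow> sgn (w g) = sgn (w v)) \<and> ((\<exists>y\<in>S. w y \<noteq> 0) \<longrightarrow> w g \<noteq> 0)"
proof -
  obtain g where g: "g \<in> S" "\<forall>w\<in>A. (\<exists>y\<in>S. w y \<noteq> 0) \<longrightarrow> w g \<noteq> 0"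
    using generic_point_in_subspace[OF fin lin S] by blast
  obtain e where e: "e > 0" "\<forall>w\<in>A. sgn (w v + e * w g) = (if w v \<noteq> 0 then sgn (w v) else sgn (w g))"
    using perturb_finite[OF fin, of "\<lambda>w. w v" "\<lambda>w. w g"] by blast
  have "sgn (w (v + e *\<^sub>R g)) = (if w v \<noteq> 0 then sgn (w v) else sgn (w g))" if "w \<in> A" for w
  proof -
    have "linear w" using lin that by blast
    then have "w (v + e *\<^sub>R g) = w v + e * w g" by (simp add: linear_add linear_scale)
    then show ?thesis using e that by simp
  qed
  then have "(w v \<noteq> 0 \<longrightarrow> sgn (w (v + e *\<^sub>R g)) = sgn (w v))
      \<and> ((\<exists>y\<in>S. w y \<noteq> 0) \<longrightarrow> w (v + e *\<^sub>R g) \<noteq> 0)" if "w \<in> A" for w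
    using g(2) that by (cases "w v = 0") (simp_all add: sgn_eq_0_iff flip: sgn_eq_0_iff[of "w (v + e *\<^sub>R g)"])
  moreover have "v + e *\<^sub>R g \<in> S" using S g \<open>v \<in> S\<close> by (simp add: subspace_add subspace_scale)
  ultimately show ?thesis by blast
qed

section \<open>Regular points and chambers\<close>

text \<open>
  For regular \<open>y\<close> this is the chamber of \<open>y\<close>. Forms vanishing identically on \<open>h_s\<close> impose no
  condition, so no exception has to be made for them.
\<close>

definition form_cone :: "real ^ 'n::{finite,linorder} \<Rightarrow> (real ^ 'n::{finite,linorder}) set"
  where "form_cone y = {z \<in> h_s. \<forall>w\<in>forms. 0 \<le> w y * w z}"

lemma weyl_iff_roots: "(x :: real ^ 'n::{finite,linorder}) \<in> weyl \<longleftrightarrow> (\<forall>w\<in>root_forms. 0 \<le> w x)"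
proof -
  have "x \<in> weyl \<longleftrightarrow> (\<forall>i j. i < j \<longrightarrow> x $ j \<le> x $ i)"
    unfolding weyl_def by (auto simp: order_le_less[of "_ :: 'n"])
  also have "\<dots> \<longleftrightarrow> (\<forall>w\<in>root_forms. 0 \<le> w x)"
    unfolding root_forms_def by force
  finally show ?thesis .
qed

text \<open>
  Subtracting a positive multiple of this vector from a point on the wall \<open>x\<^sub>i = x\<^sub>j\<close> leads out of the Weyl
  chamber within \<open>h_s\<close>.
\<close>

lemma root_nontrivial:
  assumes "i < j"
  shows "axis i 1 - axis j 1 \<in> (h_s :: (real ^ 'n::{finite,linorder}) set)"
    and "(axis i 1 - axis j 1 :: (real, 'n) vec) $ i - (axis i 1 - axis j 1 :: (real, 'n) vec) $ j = 2"
  using assms by (auto simp: h_s_def axis_def sum_subtractf)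

lemma interior_weyl_s:
  "(top_of_set h_s) interior_of weyl_s
     = {x \<in> h_s. \<forall>w\<in>root_forms. 0 < w (x :: real ^ 'n::{finite,linorder})}"
proof (intro equalityI subsetI)
  fix x :: "(real, 'n) vec" assume "x \<in> (top_of_set h_s) interior_of weyl_s"
  then obtain U where U: "openin (top_of_set h_s) U" "x \<in> U" "U \<subseteq> weyl_s"
    by (auto simp: interior_of_def)
  then obtain e where e: "e > 0" "ball x e \<inter> h_s \<subseteq> U" and x: "x \<in> h_s"
    unfolding openin_contains_ball by blast
  have "x $ j < x $ i" if "i < j" for i j
  proof -
    define d :: "(real, 'n) vec" where "d = axis i 1 - axis j 1"
    have d: "d \<in> h_s" "d $ i - d $ j = 2" using root_nontrivial[OF that] by (auto simp: d_def)
    then have "d \<noteq> 0" by auto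
    define t where "t = e / (2 * norm d)"
    have t: "t > 0" using e \<open>d \<noteq> 0\<close> by (simp add: t_def)
    have "x - t *\<^sub>R d \<in> ball x e" using e \<open>d \<noteq> 0\<close> by (simp add: dist_norm t_def)
    moreover have "x - t *\<^sub>R d \<in> h_s"
      using x d(1) by (simp add: h_s_closed)
    ultimately have "x - t *\<^sub>R d \<in> weyl_s" using e U by blast
    then have "x - t *\<^sub>R d \<in> weyl" by (simp add: weyl_s_def)
    then have "(x - t *\<^sub>R d) $ j \<le> (x - t *\<^sub>R d) $ i" using that by (auto simp: weyl_def)
    moreover have "t * (d $ i - d $ j) > 0" using t d by simp
    ultimately show ?thesis by (simp add: algebra_simps)
  qed
  then show "x \<in> {x \<in> h_s. \<forall>w\<in>root_forms. 0 < w x}" using x by (auto simp: root_forms_def)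
next
  fix x :: "(real, 'n) vec" assume x: "x \<in> {x \<in> h_s. \<forall>w\<in>root_forms. 0 < w x}"
  have "open (\<Inter>w\<in>root_forms. {x :: (real, 'n) vec. 0 < w x})"
  proof (rule open_INT)
    show "finite (root_forms :: ((real, 'n) vec \<Rightarrow> real) set)"
      using finite_forms by (rule rev_finite_subset) (auto simp: forms_def)
    show "\<forall>w\<in>root_forms. open {x :: (real, 'n) vec. 0 < w x}"
      by (intro ballI open_Collect_less continuous_on_const continuous_on_forms) (simp add: forms_def)
  qed
  then have "openin (top_of_set h_s) (h_s \<inter> (\<Inter>w\<in>root_forms. {x :: (real, 'n) vec. 0 < w x}))"
    by (simp add: openin_open_Int)
  moreover have "h_s \<inter> (\<Inter>w\<in>root_forms. {x :: (real, 'n) vec. 0 < w x}) \<subseteq> weyl_s"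
    by (auto simp: weyl_s_def weyl_iff_roots less_imp_le)
  ultimately show "x \<in> (top_of_set h_s) interior_of weyl_s"
    using x by (auto simp: interior_of_def)
qed

lemma regular_points_eq:
  "regular_points = {x \<in> h_s. (\<forall>w\<in>root_forms. 0 < w x) \<and>
     (\<forall>w\<in>forms. (\<exists>y\<in>h_s. w y \<noteq> 0) \<longrightarrow> w (x :: real ^ 'n::{finite,linorder}) \<noteq> 0)}"
proof -
  have "w x \<noteq> 0" if "\<forall>w\<in>root_forms. 0 < w x" "w \<in> root_forms" for w and x :: "(real, 'n) vec"
    using that by force
  then show ?thesis
    unfolding regular_points_def interior_weyl_s forms_def by blast
qed

lemma regular_formD:
  assumes "y \<in> regular_points" "w \<in> forms" "w y = 0" "z \<in> h_s"
  shows "w z = 0"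
  using assms by (auto simp: regular_points_eq)

text \<open>
  A form that is nontrivial on \<open>h_s\<close> has no zero among the regular points, so by the intermediate
  value property its sign is constant on a component. Conversely, the points with the signs of \<open>y\<close>
  form a convex set of regular points.
\<close>

lemma component_of_regular_point:
  fixes y :: "real ^ 'n::{finite,linorder}"
  assumes y: "y \<in> regular_points"
  shows "connected_component_set regular_points y = {z \<in> h_s. \<forall>w\<in>forms. sgn (w z) = sgn (w y)}"
    (is "_ = ?R")
proof (rule antisym)
  show "connected_component_set regular_points y \<subseteq> ?R"
  proof
    fix z assume "z \<in> connected_component_set regular_points y"
    then obtain T where T: "connected T" "T \<subseteq> regular_points" "y \<in> T" "z \<in> T"
      by (auto simp: connected_component_def)
    have "z \<in> h_s" using T by (auto simp: regular_points_eq)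
    moreover have "sgn (w z) = sgn (w y)" if w: "w \<in> forms" for w
    proof (cases "\<exists>u\<in>h_s. w u \<noteq> 0")
      case False
      with y \<open>z \<in> h_s\<close> show ?thesis by (auto simp: regular_points_eq)
    next
      case True
      have "connected (w ` T)"
        using continuous_on_forms[OF w] T(1) by (rule connected_continuous_image)
      moreover have "0 \<notin> w ` T"
        using T(2) True w by (auto simp: regular_points_eq image_iff)
      ultimately have "\<not> (w a \<le> 0 \<and> 0 \<le> w b)" if "a \<in> T" "b \<in> T" for a b
        using that connectedD_interval[of "w ` T" "w a" "w b" 0] by blast
      from this[OF T(3) T(4)] this[OF T(4) T(3)] show ?thesis
        by (auto simp: sgn_if)
    qed
    ultimately show "z \<in> ?R" by blast
  qed
  show "?R \<subseteq> connected_component_set regular_points y"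
  proof (rule connected_component_maximal)
    show "y \<in> ?R" using y by (auto simp: regular_points_eq)
    show "?R \<subseteq> regular_points"
    proof
      fix z assume z: "z \<in> ?R"
      have "0 < w z" if "w \<in> root_forms" for w
      proof -
        have "sgn (w z) = sgn (w y)" using z that by (simp add: forms_def)
        moreover have "0 < w y" using y that by (simp add: regular_points_eq)
        ultimately show ?thesis by (simp add: sgn_1_pos)
      qed
      moreover have "w z \<noteq> 0" if "w \<in> forms" "\<exists>u\<in>h_s. w u \<noteq> 0" for w
      proof -
        have "sgn (w z) = sgn (w y)" using z that by simp
        moreover have "w y \<noteq> 0" using y that by (simp add: regular_points_eq)
        ultimately show ?thesis by (metis sgn_eq_0_iff)
      qed
      ultimately show "z \<in> regular_points" using z by (simp add: regular_points_eq)
    qed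
    have "convex ?R"
    proof (rule convexI)
      fix a b and u v :: real
      assume ab: "a \<in> ?R" "b \<in> ?R" and uv: "0 \<le> u" "0 \<le> v" "u + v = 1"
      have "sgn (w (u *\<^sub>R a + v *\<^sub>R b)) = sgn (w y)" if w: "w \<in> forms" for w
      proof -
        have "w (u *\<^sub>R a + v *\<^sub>R b) = u * w a + v * w b"
          using linear_forms[OF w] by (simp add: linear_add linear_scale)
        moreover have "sgn (w a) = sgn (w y)" "sgn (w b) = sgn (w y)" using ab w by auto
        moreover have "convex {r :: real. sgn r = sgn (w y)}"
        proof -
          have "{r :: real. sgn r = sgn (w y)}
              = (if w y > 0 then {0<..} else if w y < 0 then {..<0} else {0})"
            by (auto simp: sgn_if split: if_splits)
          then show ?thesis by simp
        qed
        ultimately show ?thesis using uv convexD[of "{r :: real. sgn r = sgn (w y)}" "w a" "w b" u v]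
          by simp
      qed
      moreover have "u *\<^sub>R a + v *\<^sub>R b \<in> h_s"
        using ab by (simp add: h_s_closed)
      ultimately show "u *\<^sub>R a + v *\<^sub>R b \<in> ?R" by blast
    qed
    then show "connected ?R" by (rule convex_connected)
  qed
qed

lemma closed_form_cone: "closed (form_cone y)"
proof -
  have "form_cone y = h_s \<inter> (\<Inter>w\<in>forms. {z. 0 \<le> w y * w z})"
    by (auto simp: form_cone_def)
  moreover have "closed (\<Inter>w\<in>forms. {z. 0 \<le> w y * w z})"
    by (intro closed_INT ballI closed_Collect_le continuous_intros continuous_on_forms)
  ultimately show ?thesis by (simp add: closed_Int closed_subspace[OF subspace_h_s])
qed

text \<open>
  A point \<open>z\<close> of the closed cone is the limit of \<open>z + e *\<^sub>R y\<close> as \<open>e\<close> decreases to 0, and these points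
  have the signs of \<open>y\<close>.
\<close>

lemma closure_of_component:
  fixes y :: "real ^ 'n::{finite,linorder}"
  assumes y: "y \<in> regular_points"
  shows "closure {z \<in> h_s. \<forall>w\<in>forms. sgn (w z) = sgn (w y)} = form_cone y" (is "closure ?R = _")
proof (rule antisym)
  have "0 \<le> w y * w z" if "sgn (w z) = sgn (w y)" for w :: "(real, 'n) vec \<Rightarrow> real" and z
  proof -
    have "sgn (w y * w z) \<ge> 0" using that by (simp add: sgn_mult)
    then show ?thesis by simp
  qed
  then have "?R \<subseteq> form_cone y" by (auto simp: form_cone_def)
  then show "closure ?R \<subseteq> form_cone y" by (rule closure_minimal) (rule closed_form_cone)
  show "form_cone y \<subseteq> closure ?R"
  proof
    fix z assume z: "z \<in> form_cone y"
    have y': "y \<in> h_s" using y by (auto simp: regular_points_eq)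
    have in_R: "z + e *\<^sub>R y \<in> ?R" if e: "e > 0" for e
    proof -
      have "z + e *\<^sub>R y \<in> h_s"
        using z y' by (auto simp: form_cone_def h_s_closed)
      moreover have "sgn (w (z + e *\<^sub>R y)) = sgn (w y)" if w: "w \<in> forms" for w
      proof -
        have eq: "w (z + e *\<^sub>R y) = w z + e * w y"
          using linear_forms[OF w] by (simp add: linear_add linear_scale)
        have nn: "0 \<le> w y * w z" using z w by (auto simp: form_cone_def)
        show ?thesis
        proof (cases "w y = 0")
          case True
          then have "w z = 0" using regular_formD[OF y w] z by (auto simp: form_cone_def)
          with True show ?thesis by (simp add: eq)
        next
          case False
          show ?thesis
          proof (cases "w y > 0")
            case True
            with nn have "w z \<ge> 0" by (simp add: zero_le_mult_iff)
            moreover have "e * w y > 0" using True e by simp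
            ultimately show ?thesis using True by (simp add: eq)
          next
            case F: False
            with False have neg: "w y < 0" by simp
            with nn have "w z \<le> 0" by (auto simp: zero_le_mult_iff)
            moreover have "e * w y < 0" using neg e by (simp add: mult_pos_neg)
            ultimately show ?thesis using neg by (simp add: eq)
          qed
        qed
      qed
      ultimately show ?thesis by blast
    qed
    show "z \<in> closure ?R"
      unfolding closure_approachable
    proof (intro allI impI)
      fix e :: real assume "e > 0"
      \<comment> \<open>The 1 keeps the denominator positive: \<open>y = 0\<close> is regular in dimension one.\<close>
      define t where "t = e / (norm y + 1)"
      have pos: "norm y + 1 > 0" by (simp add: add_nonneg_pos)
      have t: "t > 0" using \<open>e > 0\<close> pos by (simp add: t_def)
      have "dist (z + t *\<^sub>R y) z = t * norm y" using t by (simp add: dist_norm)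
      also have "\<dots> < t * (norm y + 1)" using t by simp
      also have "\<dots> = e" using pos by (simp add: t_def)
      finally show "\<exists>x\<in>?R. dist x z < e" using in_R[OF t] by blast
    qed
  qed
qed

lemma chambers_eq: "chambers = form_cone ` regular_points"
proof -
  have "chambers = (\<lambda>y. closure (connected_component_set regular_points y)) ` regular_points"
    by (simp add: chambers_def components_def image_image)
  also have "\<dots> = form_cone ` regular_points"
    by (intro image_cong refl) (simp add: component_of_regular_point closure_of_component)
  finally show ?thesis .
qed

lemma form_cone_subset_weyl_s:
  assumes "y \<in> regular_points"
  shows "form_cone y \<subseteq> weyl_s"
proof
  fix z assume z: "z \<in> form_cone y"
  have "0 \<le> w z" if "w \<in> root_forms" for w
  proof -
    have "0 < w y" using assms that by (simp add: regular_points_eq)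
    moreover have "0 \<le> w y * w z" using z that by (simp add: form_cone_def forms_def)
    ultimately show ?thesis by (simp add: zero_le_mult_iff)
  qed
  then show "z \<in> weyl_s" using z by (simp add: form_cone_def weyl_s_def weyl_iff_roots)
qed

text \<open>
  Moving \<open>v\<close> towards a strictly decreasing point of \<open>h_s\<close> makes all roots positive. A second
  perturbation takes it off the weights. No sign that is nonzero at \<open>v\<close> is lost, so \<open>v\<close> is in the
  chamber of the resulting regular point.
\<close>

lemma exists_chamber_containing:
  fixes v :: "real ^ 'n::{finite,linorder}"
  assumes v: "v \<in> weyl_s"
  shows "\<exists>y\<in>regular_points. v \<in> form_cone y"
proof -
  \<comment> \<open>\<open>n\<close> times the vector \<open>mean - (1, 2, \<dots>, n)\<close>\<close>
  define g :: "(real, 'n) vec" where "g = (\<chi> i. (\<Sum>k\<in>UNIV. real (coord_pos (k::'n))) - CARD('n) * real (coord_pos i))"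
  have g: "g \<in> h_s"
    by (simp add: g_def h_s_def sum_subtractf flip: sum_distrib_left)
  have g_root: "0 < w g" if w: "w \<in> root_forms" for w
  proof -
    obtain i j :: 'n where ij: "i < j" "w = (\<lambda>x. x $ i - x $ j)"
      using w unfolding root_forms_def by blast
    have "coord_pos i < coord_pos j"
      using ij(1) coord_pos_mono[of i j] bij_coord_pos[where 'n='n]
      by (metis UNIV_I bij_betw_def inj_on_eq_iff less_le)
    then show ?thesis by (simp add: ij g_def)
  qed
  have vh: "v \<in> h_s" using v by (simp add: weyl_s_def)
  obtain e where e: "e > 0" "\<forall>w\<in>forms. sgn (w v + e * w g) = (if w v \<noteq> 0 then sgn (w v) else sgn (w g))"
    using perturb_finite[OF finite_forms, of "\<lambda>w. w v" "\<lambda>w. w g"] by blast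
  define v' where "v' = v + e *\<^sub>R g"
  have v': "sgn (w v') = (if w v \<noteq> 0 then sgn (w v) else sgn (w g))" if "w \<in> forms" for w
    using e that linear_forms[OF that] by (simp add: v'_def linear_add linear_scale)
  have "v' \<in> h_s" using vh g by (simp add: v'_def h_s_closed)
  then obtain y where y: "y \<in> h_s"
    "\<forall>w\<in>forms. (w v' \<noteq> 0 \<longrightarrow> sgn (w y) = sgn (w v')) \<and> ((\<exists>u\<in>h_s. w u \<noteq> 0) \<longrightarrow> w y \<noteq> 0)"
    using generic_point_near[OF finite_forms _ subspace_h_s, of v'] linear_forms by blast
  have "0 < w y" if w: "w \<in> root_forms" for w
  proof -
    have "w \<in> forms" using w by (simp add: forms_def)
    moreover have "0 \<le> w v" using v w by (auto simp: weyl_s_def weyl_iff_roots)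
    ultimately have "sgn (w v') = 1" using v'[of w] g_root[OF w] by auto
    then have "sgn (w y) = 1" using y(2) \<open>w \<in> forms\<close> by (metis sgn_0 zero_neq_one)
    then show ?thesis by (simp add: sgn_1_pos)
  qed
  then have "y \<in> regular_points" using y by (simp add: regular_points_eq)
  moreover have "0 \<le> w y * w v" if w: "w \<in> forms" for w
  proof (cases "w v = 0")
    case False
    then have "sgn (w y) = sgn (w v)" using v'[OF w] y(2) w by (metis sgn_eq_0_iff)
    then have "sgn (w y * w v) \<ge> 0" by (simp add: sgn_mult)
    then show ?thesis by simp
  qed simp
  ultimately show ?thesis using vh by (auto simp: form_cone_def)
qed

section \<open>Step vectors and level sets\<close>

lemma estar_bounds:
  assumes "p \<in> estar n"
  shows "fst p + snd p \<le> n" "0 < fst p + snd p" "fst p \<le> n" "snd p \<le> n"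
  using assms by (auto simp: estar_def)

lemma vec_point_nth:
  "(vec_point p :: real ^ 'n::{finite,linorder}) $ i = (if coord_pos i \<le> fst p then 1
     else if CARD('n) < coord_pos i + snd p then - 1 else 0)"
  by (simp add: vec_point_def)

lemma vec_point_weyl: "(vec_point p :: real ^ 'n::{finite,linorder}) \<in> weyl"
proof -
  have "(vec_point p :: (real, 'n) vec) $ j \<le> (vec_point p :: (real, 'n) vec) $ i" if "i \<le> j" for i j
    using coord_pos_mono[OF that] by (auto simp: vec_point_nth)
  then show ?thesis by (simp add: weyl_def)
qed

lemma card_vec_point_eq_1:
  assumes "p \<in> estar CARD('n)"
  shows "card {i. (vec_point p :: real ^ 'n::{finite,linorder}) $ i = 1} = fst p"
proof -
  have "{i. (vec_point p :: (real, 'n) vec) $ i = 1} = {i. coord_pos i \<le> fst p}"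
    by (simp add: vec_point_nth)
  then show ?thesis using card_initial_indices estar_bounds(3)[OF assms] by simp
qed

lemma card_vec_point_eq_minus_1:
  assumes "p \<in> estar CARD('n)"
  shows "card {i. (vec_point p :: real ^ 'n::{finite,linorder}) $ i = - 1} = snd p"
proof -
  have "(vec_point p :: (real, 'n) vec) $ i = - 1 \<longleftrightarrow> CARD('n) < coord_pos i + snd p" for i
    using estar_bounds(1)[OF assms] by (auto simp: vec_point_nth)
  then show ?thesis using card_final_indices estar_bounds(4)[OF assms] by simp
qed

lemma vec_point_values: "vec_point p $ i \<in> {1, 0, -1 :: real}"
  by (simp add: vec_point_nth)

lemma sum_vec_point:
  assumes "p \<in> estar CARD('n)"
  shows "(\<Sum>i\<in>UNIV. (vec_point p :: real ^ 'n::{finite,linorder}) $ i) = of_int (signature p)"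
proof -
  let ?v = "vec_point p :: (real, 'n) vec"
  have "(\<Sum>i\<in>UNIV. ?v $ i) = (\<Sum>i\<in>UNIV. of_bool (?v $ i = 1) - of_bool (?v $ i = - 1))"
  proof (rule sum.cong[OF refl])
    fix i show "?v $ i = of_bool (?v $ i = 1) - of_bool (?v $ i = - 1)"
      using vec_point_values[of p i] by auto
  qed
  also have "\<dots> = of_int (signature p)"
    using card_vec_point_eq_1[OF assms] card_vec_point_eq_minus_1[OF assms]
    by (simp add: sum_subtractf signature_def)
  finally show ?thesis .
qed

text \<open>
  For \<open>p \<le> q\<close> the blocks of 1 and -1 of \<open>p\<close> are contained in those of \<open>q\<close>; the two blocks of \<open>q\<close>
  do not overlap because together they have at most \<open>n\<close> entries.
\<close>

lemma vec_point_nested: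
  assumes "p \<le> q" "q \<in> estar CARD('n)"
  shows "(vec_point p :: real ^ 'n::{finite,linorder}) $ i = 0 \<or>
         (vec_point p :: real ^ 'n::{finite,linorder}) $ i = (vec_point q :: real ^ 'n::{finite,linorder}) $ i"
  using assms(1) estar_bounds[OF assms(2)] by (auto simp: vec_point_nth less_eq_prod_def)

definition level :: "real ^ 'n::{finite,linorder} \<Rightarrow> real \<Rightarrow> nat \<times> nat"
  where "level x t = (card {i. t \<le> x $ i}, card {i. x $ i \<le> - t})"

text \<open>
  The level \<open>(0, 0)\<close> is left out because it occurs for every vector, at large \<open>t\<close>. What remains is a
  chain that depends only on the ray of the vector.
\<close>

definition levels :: "real ^ 'n::{finite,linorder} \<Rightarrow> (nat \<times> nat) set"
  where "levels x = level x ` {0<..} - {(0, 0)}"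

lemma level_antimono: "s \<le> t \<Longrightarrow> level x t \<le> level x s"
  unfolding level_def less_eq_prod_def by (auto intro!: card_mono)

lemma level_in_estar:
  fixes x :: "real ^ 'n::{finite,linorder}"
  assumes "t > 0" "level x t \<noteq> (0, 0)"
  shows "level x t \<in> estar CARD('n)"
proof -
  have "card {i. t \<le> x $ i} + card {i. x $ i \<le> - t} = card ({i. t \<le> x $ i} \<union> {i. x $ i \<le> - t})"
    using assms(1) by (intro card_Un_disjoint[symmetric]) auto
  also have "\<dots> \<le> CARD('n)" by (rule card_mono) auto
  finally have "fst (level x t) + snd (level x t) \<le> CARD('n)" by (simp add: level_def)
  then show ?thesis using assms(2) unfolding estar_def by (cases "level x t") auto
qed

text \<open>
  In the Weyl chamber the coordinates \<open>\<ge> t\<close> form an initial segment of the indices and those \<open>\<le> -t\<close>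
  a final one, so that the numbers of such coordinates determine where they are.
\<close>

lemma vec_point_level:
  fixes x :: "real ^ 'n::{finite,linorder}"
  assumes x: "x \<in> weyl" and t: "t > 0"
  shows "(vec_point (level x t) :: real ^ 'n::{finite,linorder}) $ i
    = (if t \<le> x $ i then 1 else if x $ i \<le> - t then - 1 else 0)"
proof -
  have mono: "x $ j \<le> x $ k" if "k \<le> j" for k j using x that by (simp add: weyl_def)
  have "coord_pos i \<le> card {j. t \<le> x $ j} \<longleftrightarrow> t \<le> x $ i"
  proof
    assume "t \<le> x $ i"
    then have "{j. j \<le> i} \<subseteq> {j. t \<le> x $ j}" using mono by (auto intro: order_trans)
    then show "coord_pos i \<le> card {j. t \<le> x $ j}" unfolding coord_pos_def by (intro card_mono) auto
  next
    assume le: "coord_pos i \<le> card {j. t \<le> x $ j}"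
    show "t \<le> x $ i"
    proof (rule ccontr)
      assume "\<not> t \<le> x $ i"
      then have "{j. t \<le> x $ j} \<subseteq> {j. j \<le> i} - {i}"
        using mono[of i] by (smt (verit) Diff_iff linorder_le_cases mem_Collect_eq singletonD subsetI)
      then have "card {j. t \<le> x $ j} \<le> card ({j. j \<le> i} - {i})" by (intro card_mono) auto
      also have "\<dots> < coord_pos i"
        unfolding coord_pos_def by (rule card_Diff1_less) auto
      finally show False using le by simp
    qed
  qed
  moreover have "CARD('n) < coord_pos i + card {j. x $ j \<le> - t} \<longleftrightarrow> x $ i \<le> - t"
  proof -
    have above: "coord_pos i + card {j. i < j} = CARD('n)"
    proof -
      have "card {j. j \<le> i} + card {j. i < j} = card ({j. j \<le> i} \<union> {j. i < j})"
        by (intro card_Un_disjoint[symmetric]) auto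
      also have "{j. j \<le> i} \<union> {j. i < j} = UNIV" by auto
      finally show ?thesis by (simp add: coord_pos_def)
    qed
    show ?thesis
    proof
      assume "x $ i \<le> - t"
      then have "insert i {j. i < j} \<subseteq> {j. x $ j \<le> - t}"
        using mono[of i] by (smt (verit) insert_iff less_imp_le mem_Collect_eq subsetI)
      then have "card (insert i {j. i < j}) \<le> card {j. x $ j \<le> - t}" by (intro card_mono) auto
      then show "CARD('n) < coord_pos i + card {j. x $ j \<le> - t}" using above by simp
    next
      assume lt: "CARD('n) < coord_pos i + card {j. x $ j \<le> - t}"
      show "x $ i \<le> - t"
      proof (rule ccontr)
        assume "\<not> x $ i \<le> - t"
        then have "{j. x $ j \<le> - t} \<subseteq> {j. i < j}"
          using mono[of _ i] by (smt (verit) linorder_not_le mem_Collect_eq subsetI)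
        then have "card {j. x $ j \<le> - t} \<le> card {j. i < j}" by (intro card_mono) auto
        then show False using lt above by simp
      qed
    qed
  qed
  ultimately show ?thesis by (simp add: vec_point_nth level_def)
qed

text \<open>
  The vector takes the values \<open>\<plusminus>(s + s')\<close> on the blocks of \<open>p\<close>, \<open>\<plusminus>s'\<close> on the rest of the blocks of \<open>q\<close>,
  and 0 elsewhere. With \<open>p = q\<close> and \<open>s = 0\<close> this covers a single \<open>vec_point\<close> as well.
\<close>

lemma level_combination:
  fixes v :: "real ^ 'n::{finite,linorder}"
  assumes pq: "p \<le> q" "p \<in> estar CARD('n)" "q \<in> estar CARD('n)"
    and s: "0 \<le> s" "0 < s'" and t: "t > 0"
    and v: "v = s *\<^sub>R vec_point p + s' *\<^sub>R vec_point q"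
  shows "level v t = (if t \<le> s' then q else if t \<le> s + s' then p else (0, 0))"
proof -
  let ?p = "vec_point p :: (real, 'n) vec" and ?q = "vec_point q :: (real, 'n) vec"
  have cases: "?p $ i = 0 \<and> ?q $ i = 0 \<or> ?p $ i = 0 \<and> ?q $ i = 1 \<or> ?p $ i = 0 \<and> ?q $ i = - 1
      \<or> ?p $ i = 1 \<and> ?q $ i = 1 \<or> ?p $ i = - 1 \<and> ?q $ i = - 1" for i
    using vec_point_nested[OF pq(1,3), of i] vec_point_values[of p i] vec_point_values[of q i] by auto
  have vi: "v $ i = s * ?p $ i + s' * ?q $ i" for i by (simp add: v)
  consider "t \<le> s'" | "s' < t" "t \<le> s + s'" | "s + s' < t" by linarith
  then show ?thesis
  proof cases
    case 1
    have "t \<le> v $ i \<longleftrightarrow> ?q $ i = 1" "v $ i \<le> - t \<longleftrightarrow> ?q $ i = - 1" for i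
      using cases[of i] s t 1 by (auto simp: vi)
    then show ?thesis
      using 1 card_vec_point_eq_1[OF pq(3)] card_vec_point_eq_minus_1[OF pq(3)]
      by (simp add: level_def)
  next
    case 2
    have "t \<le> v $ i \<longleftrightarrow> ?p $ i = 1" "v $ i \<le> - t \<longleftrightarrow> ?p $ i = - 1" for i
      using cases[of i] s t 2 by (auto simp: vi)
    then show ?thesis
      using 2 card_vec_point_eq_1[OF pq(2)] card_vec_point_eq_minus_1[OF pq(2)]
      by (simp add: level_def)
  next
    case 3
    have "\<not> t \<le> v $ i" "\<not> v $ i \<le> - t" for i
      using cases[of i] s t 3 by (auto simp: vi)
    then show ?thesis using 3 s by (simp add: level_def)
  qed
qed

lemma level_scale: "c > 0 \<Longrightarrow> level (c *\<^sub>R x) t = level x (t / c)"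
proof -
  assume "c > 0"
  then have "t \<le> c * r \<longleftrightarrow> t / c \<le> r" "c * r \<le> - t \<longleftrightarrow> r \<le> - (t / c)" for r
    by (simp_all add: field_simps)
  then show ?thesis by (simp add: level_def)
qed

lemma levels_scale:
  assumes "c > 0"
  shows "levels (c *\<^sub>R x) = levels x"
proof -
  have "level (c *\<^sub>R x) ` {0<..} = level x ` ((\<lambda>t. t / c) ` {0<..})"
    using assms by (simp add: level_scale image_image)
  also have "(\<lambda>t. t / c) ` {0<..} = {0<..}"
  proof (intro equalityI subsetI)
    fix t :: real assume "t \<in> {0<..}"
    then show "t \<in> (\<lambda>t. t / c) ` {0<..}" using assms by (intro image_eqI[of _ _ "t * c"]) auto
  qed (use assms in auto)
  finally show ?thesis by (simp add: levels_def)
qed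

text \<open>
  The layer cake formula for one coordinate: the integrand is \<open>sgn r\<close> on \<open>[0, \<bar>r\<bar>]\<close> and 0 beyond it.
\<close>

lemma has_integral_layer_cake:
  fixes r a :: real
  assumes "\<bar>r\<bar> \<le> a"
  shows "((\<lambda>t. of_bool (t \<le> r) - of_bool (r \<le> - t)) has_integral r) {0..a}"
proof (cases "r = 0")
  case True
  have "((\<lambda>t. 0) has_integral 0) {0..a}" by simp
  then have "((\<lambda>t. of_bool (t \<le> r) - of_bool (r \<le> - t)) has_integral (0::real)) {0..a}"
    by (rule has_integral_eq[rotated]) (use True in auto)
  then show ?thesis using True by simp
next
  case False
  have "((\<lambda>t. sgn r) has_integral r) {0..\<bar>r\<bar>}"
    using has_integral_const_real[of "sgn r" 0 "\<bar>r\<bar>"] by (simp add: abs_mult_sgn)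
  moreover have "{0..\<bar>r\<bar>} \<subseteq> {0..a}" using assms by auto
  ultimately have "((\<lambda>t. if t \<in> {0..\<bar>r\<bar>} then sgn r else 0) has_integral r) {0..a}"
    by (simp only: has_integral_restrict)
  then show ?thesis
    by (rule has_integral_eq[rotated]) (use False in \<open>auto simp: sgn_if\<close>)
qed

text \<open>
  Summing the layer cake formula over the coordinates: at \<open>t\<close> the summands add up to the number of
  coordinates \<open>\<ge> t\<close> minus the number of those \<open>\<le> -t\<close>.
\<close>

lemma sum_eq_integral_signature:
  fixes x :: "real ^ 'n::{finite,linorder}"
  assumes "\<And>i. \<bar>x $ i\<bar> \<le> a"
  shows "((\<lambda>t. of_int (signature (level x t))) has_integral (\<Sum>i\<in>UNIV. x $ i)) {0..a}"
proof -
  have "((\<lambda>t. \<Sum>i\<in>UNIV. of_bool (t \<le> x $ i) - of_bool (x $ i \<le> - t)) has_integral (\<Sum>i\<in>UNIV. x $ i)) {0..a}"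
    by (intro has_integral_sum has_integral_layer_cake assms) auto
  then show ?thesis by (simp add: signature_def level_def sum_subtractf)
qed

text \<open>
  The factor \<open>c\<close> is a sign and serves to treat positive and negative signatures together. An
  integer that is positive is at least 1, so the integral is at least \<open>a\<close>.
\<close>

lemma sum_pos_if_levels_pos:
  fixes x :: "real ^ 'n::{finite,linorder}"
  assumes a: "\<And>i. \<bar>x $ i\<bar> \<le> a" "a > 0" and c: "c = 1 \<or> c = - 1"
    and pos: "\<And>t. 0 < t \<Longrightarrow> t \<le> a \<Longrightarrow> c * signature (level x t) > 0"
  shows "of_int c * (\<Sum>i\<in>UNIV. x $ i) > 0"
proof -
  let ?f = "\<lambda>t. of_int c * of_int (signature (level x t)) :: real"
  have f: "(?f has_integral of_int c * (\<Sum>i\<in>UNIV. x $ i)) {0..a}"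
    by (rule has_integral_mult_right[OF sum_eq_integral_signature[OF a(1)]])
  \<comment> \<open>Only positive \<open>t\<close> are covered by the hypothesis, so the signature is unknown at \<open>t = 0\<close>; the value there is replaced by 1.\<close>
  have int_f: "((\<lambda>t. if t = 0 then 1 else ?f t) has_integral of_int c * (\<Sum>i\<in>UNIV. x $ i)) {0..a}"
    by (rule has_integral_spike_finite[OF _ _ f, of "{0}"]) auto
  have int_1: "((\<lambda>t. 1 :: real) has_integral a) {0..a}"
    using has_integral_const_real[of "1::real" 0 a] a(2) by simp
  have le: "1 \<le> (if t = 0 then 1 else ?f t)" if "t \<in> {0..a}" for t
  proof (cases "t = 0")
    case False
    then have "1 \<le> c * signature (level x t)" using pos[of t] that by auto
    then have "(1::real) \<le> of_int (c * signature (level x t))" by linarith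
    then show ?thesis using False by simp
  qed simp
  have "a \<le> of_int c * (\<Sum>i\<in>UNIV. x $ i)"
    using int_1 int_f le by (rule has_integral_le)
  then show ?thesis using a(2) by simp
qed

text \<open>
  The signatures of the levels at \<open>0 < t \<le> a\<close>, where \<open>a\<close> is the largest absolute value of a
  coordinate, integrate to the coordinate sum 0. If none of them is zero, they cannot all have the
  sign of the one at \<open>a\<close>.
\<close>

lemma balanced_levels_exist:
  fixes x :: "real ^ 'n::{finite,linorder}"
  assumes "x \<in> h_s" "x \<noteq> 0"
  obtains t where "t > 0" "level x t \<noteq> (0, 0)" "signature (level x t) = 0"
  | s t where "0 < s" "s < t" "signature (level x t) * signature (level x s) < 0"
proof -
  define a where "a = Max (range (\<lambda>i. \<bar>x $ i\<bar>))"
  have a: "\<bar>x $ i\<bar> \<le> a" for i by (simp add: a_def)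
  obtain k where k: "x $ k \<noteq> 0" using assms(2) by (auto simp: vec_eq_iff)
  have "a > 0" using a[of k] k by linarith
  obtain m where m: "\<bar>x $ m\<bar> = a"
  proof -
    have "a \<in> range (\<lambda>i. \<bar>x $ i\<bar>)" unfolding a_def by (rule Max_in) auto
    then show thesis using that by auto
  qed
  have nonzero: "level x t \<noteq> (0, 0)" if "0 < t" "t \<le> a" for t
  proof -
    have "t \<le> x $ m \<or> x $ m \<le> - t" using m that by linarith
    then have "{i. t \<le> x $ i} \<noteq> {} \<or> {i. x $ i \<le> - t} \<noteq> {}" by blast
    then show ?thesis by (simp add: level_def)
  qed
  have sum0: "(\<Sum>i\<in>UNIV. x $ i) = 0" using assms(1) by (simp add: h_s_def)
  have trich: "signature (level x a) = 0 \<or> signature (level x t) = 0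
      \<or> signature (level x t) * signature (level x a) < 0
      \<or> signature (level x t) * signature (level x a) > 0" for t
    by (cases "signature (level x t) * signature (level x a)" "0 :: int" rule: linorder_cases) auto
  consider (null) t where "0 < t" "t \<le> a" "signature (level x t) = 0"
    | (opp) t where "0 < t" "t \<le> a" "signature (level x t) * signature (level x a) < 0"
    | (same) "\<And>t. 0 < t \<Longrightarrow> t \<le> a \<Longrightarrow> signature (level x t) * signature (level x a) > 0"
    using trich \<open>a > 0\<close> by (metis order_refl)
  then show thesis
  proof cases
    case null
    then show thesis using that(1) nonzero by blast
  next
    case opp
    then have "t \<noteq> a" by (auto simp: mult_less_0_iff)
    then show thesis using that(2)[of t a] opp by (simp add: mult.commute)
  next
    case same
    define c where "c = sgn (signature (level x a))"
    have "signature (level x a) \<noteq> 0" using same[of a] \<open>a > 0\<close> by auto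
    then have "c = 1 \<or> c = - 1" by (auto simp: c_def sgn_if)
    moreover have "c * signature (level x t) > 0" if "0 < t" "t \<le> a" for t
      using same[OF that] by (auto simp: c_def sgn_if zero_less_mult_iff split: if_splits)
    ultimately have "of_int c * (\<Sum>i\<in>UNIV. x $ i) > 0"
      using sum_pos_if_levels_pos[OF a \<open>a > 0\<close>] by blast
    then show thesis using sum0 by simp
  qed
qed

section \<open>Vectors subordinate to a face\<close>

text \<open>
  In terms of the arrangement: \<open>e\<close> is in the closed face (of the central arrangement of all forms in
  the whole space) whose relative interior contains \<open>d\<close>.
\<close>

definition subordinate :: "real ^ 'n::{finite,linorder} \<Rightarrow> real ^ 'n::{finite,linorder} \<Rightarrow> bool"
  where "subordinate e d \<longleftrightarrow> (\<forall>w\<in>forms. 0 \<le> w d * w e \<and> (w d = 0 \<longrightarrow> w e = 0))"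

text \<open>
  The map \<open>f\<close> that takes the coordinates of \<open>x\<close> to those of the step vector is odd and monotone, so
  it is compatible with the signs of \<open>r\<close>, \<open>r - s\<close> and \<open>r + s\<close>.
\<close>

lemma subordinate_level:
  fixes x :: "real ^ 'n::{finite,linorder}"
  assumes "x \<in> weyl" "t > 0"
  shows "subordinate (vec_point (level x t)) x"
proof -
  define f where "f r = (if t \<le> r then 1 else if r \<le> - t then - 1 else 0 :: real)" for r
  have v: "(vec_point (level x t) :: (real, 'n) vec) $ i = f (x $ i)" for i
    using vec_point_level[OF assms] by (simp add: f_def)
  have "0 \<le> r * f r \<and> (r = 0 \<longrightarrow> f r = 0)" for r
    using assms(2) by (auto simp: f_def)
  moreover have "0 \<le> (r - s) * (f r - f s) \<and> (r - s = 0 \<longrightarrow> f r - f s = 0)" for r s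
    using assms(2) by (auto simp: f_def zero_le_mult_iff)
  moreover have "0 \<le> (r + s) * (f r + f s) \<and> (r + s = 0 \<longrightarrow> f r + f s = 0)" for r s
    using assms(2) by (auto simp: f_def zero_le_mult_iff)
  ultimately show ?thesis
    unfolding subordinate_def by (auto elim!: forms_cases simp: v)
qed

lemma subordinate_combination:
  fixes d e e' :: "real ^ 'n::{finite,linorder}"
  assumes "subordinate e d" "subordinate e' d" "0 \<le> s" "0 \<le> s'"
  shows "subordinate (s *\<^sub>R e + s' *\<^sub>R e') d"
  unfolding subordinate_def
proof
  fix w :: "(real, 'n) vec \<Rightarrow> real" assume w: "w \<in> forms"
  have "w (s *\<^sub>R e + s' *\<^sub>R e') = s * w e + s' * w e'"
    using linear_forms[OF w] by (simp add: linear_add linear_scale)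
  moreover have "w d * (s * w e + s' * w e') = s * (w d * w e) + s' * (w d * w e')"
    by (simp add: algebra_simps)
  ultimately show "0 \<le> w d * w (s *\<^sub>R e + s' *\<^sub>R e') \<and> (w d = 0 \<longrightarrow> w (s *\<^sub>R e + s' *\<^sub>R e') = 0)"
    using assms w by (auto simp: subordinate_def)
qed

text \<open>
  Where a form is nonzero at \<open>d\<close>, subtracting a small multiple of \<open>e\<close> does not change its sign;
  where it vanishes at \<open>d\<close>, it vanishes at \<open>e\<close> too. So \<open>d\<close> is the sum of a positive multiple of \<open>e\<close>
  and another point of the cone.
\<close>

lemma subordinate_in_form_cone:
  fixes d e :: "real ^ 'n::{finite,linorder}"
  assumes "d \<in> form_cone y" "e \<in> h_s" "subordinate e d"
  shows "e \<in> form_cone y" "\<exists>r>0. d - r *\<^sub>R e \<in> form_cone y"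
proof -
  have nn: "0 \<le> w y * w d" if "w \<in> forms" for w using assms(1) that by (simp add: form_cone_def)
  have sub: "0 \<le> w d * w e" "w d = 0 \<Longrightarrow> w e = 0" if "w \<in> forms" for w
    using assms(3) that by (auto simp: subordinate_def)
  have "0 \<le> w y * w e" if "w \<in> forms" for w
    using nn[OF that] sub[OF that] by (cases "w d = 0") (auto simp: zero_le_mult_iff)
  then show "e \<in> form_cone y" using assms(2) by (simp add: form_cone_def)
  obtain r where r: "r > 0"
    "\<forall>w\<in>forms. sgn (w d + r * w (- e)) = (if w d \<noteq> 0 then sgn (w d) else sgn (w (- e)))"
    using perturb_finite[OF finite_forms, of "\<lambda>w. w d" "\<lambda>w. w (- e)"] by blast
  have "0 \<le> w y * w (d - r *\<^sub>R e)" if w: "w \<in> forms" for w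
  proof -
    have "w (d - r *\<^sub>R e) = w d - r * w e" and "w (- e) = - w e"
      using linear_forms[OF w] by (simp_all add: linear_diff linear_scale linear_neg)
    then have "sgn (w (d - r *\<^sub>R e)) = sgn (w d)"
      using r(2) w sub(2)[OF w] by (cases "w d = 0") auto
    then have "sgn (w y * w (d - r *\<^sub>R e)) = sgn (w y * w d)" by (simp add: sgn_mult)
    then show ?thesis using nn[OF w] by (metis zero_le_sgn_iff)
  qed
  moreover have "d - r *\<^sub>R e \<in> h_s" using assms by (simp add: form_cone_def h_s_closed)
  ultimately show "\<exists>r>0. d - r *\<^sub>R e \<in> form_cone y" using r(1) by (auto simp: form_cone_def)
qed

text \<open>
  The roots, sums and coordinates that vanish on \<open>v\<close> force \<open>z\<close> to be equal, opposite or zero in the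
  coordinates where \<open>v\<close> is. So \<open>z\<close> is determined by one value for \<open>v\<^sub>i = s'\<close> and one for
  \<open>v\<^sub>i = s + s'\<close>.
\<close>

lemma rigid_combination:
  fixes v z :: "real ^ 'n::{finite,linorder}"
  assumes pq: "p \<le> q" "q \<in> estar CARD('n)"
    and s: "0 \<le> s" "0 < s'"
    and v: "v = s *\<^sub>R vec_point p + s' *\<^sub>R vec_point q"
    and z: "\<And>w. w \<in> forms \<Longrightarrow> w v = 0 \<Longrightarrow> w z = 0"
  shows "\<exists>\<alpha> \<beta>. z = \<alpha> *\<^sub>R vec_point p + \<beta> *\<^sub>R vec_point q"
proof -
  let ?p = "vec_point p :: (real, 'n) vec" and ?q = "vec_point q :: (real, 'n) vec"
  have eq: "z $ i = z $ j" if "v $ i = v $ j" for i j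
    using that z[OF diff_in_forms, of i j] z[OF diff_in_forms, of j i]
    by (cases i j rule: linorder_cases) auto
  have opp: "z $ i = - z $ j" if "v $ i = - v $ j" for i j
  proof (cases i j rule: linorder_cases)
    case equal
    then show ?thesis using that z[OF coordinate_in_forms, of i] by auto
  qed (use that z[OF sum_in_forms, of i j] z[OF sum_in_forms, of j i] in auto)
  \<comment> \<open>The value that \<open>z\<close> takes where \<open>v\<close> equals \<open>r\<close>; arbitrary if \<open>\<plusminus>r\<close> does not occur in \<open>v\<close>.\<close>
  have val: "\<exists>c. \<forall>i. (v $ i = r \<longrightarrow> z $ i = c) \<and> (v $ i = - r \<longrightarrow> z $ i = - c)" for r
  proof (cases "\<exists>k. v $ k = r \<or> v $ k = - r")
    case True
    then obtain k where k: "v $ k = r \<or> v $ k = - r" by blast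
    then show ?thesis
    proof
      assume "v $ k = r"
      then show ?thesis by (intro exI[of _ "z $ k"] allI conjI impI) (auto intro: eq opp)
    next
      assume "v $ k = - r"
      then show ?thesis by (intro exI[of _ "- z $ k"] allI conjI impI) (auto intro: eq opp)
    qed
  qed auto
  obtain c where c: "\<And>i. v $ i = s' \<Longrightarrow> z $ i = c" "\<And>i. v $ i = - s' \<Longrightarrow> z $ i = - c"
    using val[of s'] by blast
  obtain c' where c': "\<And>i. v $ i = s + s' \<Longrightarrow> z $ i = c'" "\<And>i. v $ i = - (s + s') \<Longrightarrow> z $ i = - c'"
    using val[of "s + s'"] by blast
  have "z $ i = (c' - c) * ?p $ i + c * ?q $ i" for i
  proof -
    have vi: "v $ i = s * ?p $ i + s' * ?q $ i" by (simp add: v)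
    consider "?p $ i = 0" "?q $ i = 0" | "?p $ i = 0" "?q $ i = 1" | "?p $ i = 0" "?q $ i = - 1"
      | "?p $ i = 1" "?q $ i = 1" | "?p $ i = - 1" "?q $ i = - 1"
      using vec_point_nested[OF pq, of i] vec_point_values[of p i] vec_point_values[of q i] by auto
    then show ?thesis
    proof cases
      case 1
      then show ?thesis using z[OF coordinate_in_forms, of i] by (simp add: vi)
    next
      case 2
      then show ?thesis using c(1)[of i] by (simp add: vi)
    next
      case 3
      then show ?thesis using c(2)[of i] by (simp add: vi)
    next
      case 4
      then show ?thesis using c'(1)[of i] by (simp add: vi)
    next
      case 5
      then show ?thesis using c'(2)[of i] by (simp add: vi)
    qed
  qed
  then have "z = (c' - c) *\<^sub>R ?p + c *\<^sub>R ?q" by (simp add: vec_eq_iff)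
  then show ?thesis by blast
qed

section \<open>The vectors attached to null points and balanced pairs\<close>

abbreviation ray_index :: "nat \<Rightarrow> (nat \<times> nat + (nat \<times> nat) \<times> (nat \<times> nat)) set"
  where "ray_index n \<equiv> null_points n <+> balanced_pairs n"

text \<open>
  The chain in \<open>estar n\<close> from which an index is formed. By \<open>levels_vec_of\<close> it can be read off the
  associated vector.
\<close>

fun index_chain :: "nat \<times> nat + (nat \<times> nat) \<times> (nat \<times> nat) \<Rightarrow> (nat \<times> nat) set"
  where "index_chain (Inl p) = {p}" | "index_chain (Inr (p, q)) = {p, q}"

lemma inj_on_index_chain: "inj_on index_chain (ray_index n)"
  by (rule inj_onI) (auto simp: balanced_pairs_def doubleton_eq_iff dest: less_asym)

text \<open>
  A common form for both kinds of indices. A null point \<open>p\<close> is treated as the pair \<open>(p, p)\<close> with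
  coefficients 0 and 1. The last clause holds because for a balanced pair the signatures are nonzero,
  so \<open>\<alpha> \<sigma>(p) + \<beta> \<sigma>(q) = 0\<close> has a one-dimensional space of solutions.
\<close>

lemma vec_of_combination:
  assumes "u \<in> ray_index CARD('n)"
  obtains p q and s s' :: real where "p \<le> q" "p \<in> estar CARD('n)" "q \<in> estar CARD('n)" "0 \<le> s" "0 < s'"
    "vec_of u = s *\<^sub>R vec_point p + s' *\<^sub>R (vec_point q :: real ^ 'n::{finite,linorder})"
    "s * signature p + s' * signature q = 0"
    "index_chain u = (if s = 0 then {q} else {p, q})"
    "\<And>(\<alpha> :: real) (\<beta> :: real). \<alpha> * signature p + \<beta> * signature q = 0 \<Longrightarrow>
      \<exists>t. \<alpha> *\<^sub>R vec_point p + \<beta> *\<^sub>R vec_point q = t *\<^sub>R (vec_of u :: real ^ 'n::{finite,linorder})"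
  using assms
proof (elim PlusE)
  fix p assume u: "u = Inl p" and p: "p \<in> null_points CARD('n)"
  have "\<exists>t. \<alpha> *\<^sub>R vec_point p + \<beta> *\<^sub>R vec_point p = t *\<^sub>R (vec_of u :: (real, 'n) vec)" for \<alpha> \<beta> :: real
    using u by (intro exI[of _ "\<alpha> + \<beta>"]) (simp add: vec_of_def scaleR_add_left)
  then show thesis
    using p by (intro that[of p p 0 1]) (auto simp: null_points_def u vec_of_def)
next
  fix pq assume u: "u = Inr pq" and pq: "pq \<in> balanced_pairs CARD('n)"
  obtain p q where [simp]: "pq = (p, q)" by (cases pq)
  have *: "p \<in> estar CARD('n)" "q \<in> estar CARD('n)" "p < q" "signature p * signature q < 0"
    using pq by (auto simp: balanced_pairs_def)
  define s s' where "s = real_of_int \<bar>signature q\<bar>" and "s' = real_of_int \<bar>signature p\<bar>"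
  have pos: "s > 0" "s' > 0" using *(4) by (auto simp: s_def s'_def mult_less_0_iff)
  have vec: "vec_of u = s *\<^sub>R vec_point p + s' *\<^sub>R (vec_point q :: (real, 'n) vec)"
    by (simp add: u vec_of_def vec_pair_def s_def s'_def)
  have sig: "real_of_int (signature p) = s' \<and> real_of_int (signature q) = - s
      \<or> real_of_int (signature p) = - s' \<and> real_of_int (signature q) = s"
    using *(4) by (auto simp: s_def s'_def mult_less_0_iff)
  have span: "\<exists>t. \<alpha> *\<^sub>R vec_point p + \<beta> *\<^sub>R vec_point q = t *\<^sub>R (vec_of u :: (real, 'n) vec)"
    if "\<alpha> * signature p + \<beta> * signature q = 0" for \<alpha> \<beta> :: real
  proof (intro exI[of _ "\<alpha> / s"])
    have "\<alpha> * s' = \<beta> * s" using that sig by auto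
    then have "\<alpha> / s * s' = \<beta>" using pos by (simp add: field_simps)
    then show "\<alpha> *\<^sub>R vec_point p + \<beta> *\<^sub>R vec_point q = (\<alpha> / s) *\<^sub>R (vec_of u :: (real, 'n) vec)"
      using pos by (simp add: vec scaleR_add_right)
  qed
  show thesis
    by (rule that[OF _ *(1,2) _ pos(2) vec _ _ span]) (use pos sig *(3) u in \<open>auto simp: mult.commute\<close>)
qed

lemma levels_vec_of:
  assumes "u \<in> ray_index CARD('n)"
  shows "levels (vec_of u :: real ^ 'n::{finite,linorder}) = index_chain u"
proof -
  let ?v = "vec_of u :: (real, 'n) vec"
  obtain p q and s s' :: real where *: "p \<le> q" "p \<in> estar CARD('n)" "q \<in> estar CARD('n)" "0 \<le> s" "0 < s'"
    "?v = s *\<^sub>R vec_point p + s' *\<^sub>R vec_point q" "s * signature p + s' * signature q = 0"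
    "index_chain u = (if s = 0 then {q} else {p, q})"
    and span: "\<And>(\<alpha> :: real) (\<beta> :: real). \<alpha> * signature p + \<beta> * signature q = 0 \<Longrightarrow>
      \<exists>t. \<alpha> *\<^sub>R vec_point p + \<beta> *\<^sub>R vec_point q = t *\<^sub>R ?v"
    by (rule vec_of_combination[OF assms]) blast
  have lev: "level ?v t = (if t \<le> s' then q else if t \<le> s + s' then p else (0, 0))" if "t > 0" for t
    by (rule level_combination[OF *(1-5) that *(6)])
  have "p \<noteq> (0, 0)" "q \<noteq> (0, 0)" using *(2,3) by (auto simp: estar_def)
  moreover have "q \<in> level ?v ` {0<..}" using lev[of s'] *(5) by (intro image_eqI[of _ _ s']) auto
  moreover have "p \<in> level ?v ` {0<..}" if "s \<noteq> 0"
    using lev[of "s + s'"] *(4,5) that by (intro image_eqI[of _ _ "s + s'"]) auto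
  moreover have "level ?v ` {0<..} \<subseteq> {q, (0, 0)} \<union> (if s = 0 then {} else {p})"
    using lev by (auto split: if_splits)
  ultimately show ?thesis by (auto simp: levels_def *(8) split: if_splits)
qed

lemma vec_of_nonzero:
  assumes "u \<in> ray_index CARD('n)"
  shows "vec_of u \<noteq> (0 :: real ^ 'n::{finite,linorder})"
proof
  assume "vec_of u = (0 :: (real, 'n) vec)"
  then have "levels (vec_of u :: (real, 'n) vec) = {}" by (auto simp: levels_def level_def)
  then show False using levels_vec_of[OF assms] by (cases u rule: index_chain.cases) auto
qed

lemma vec_of_weyl_s:
  assumes "u \<in> ray_index CARD('n)"
  shows "(vec_of u :: real ^ 'n::{finite,linorder}) \<in> weyl_s"
proof -
  let ?v = "vec_of u :: (real, 'n) vec"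
  obtain p q and s s' :: real where *: "p \<le> q" "p \<in> estar CARD('n)" "q \<in> estar CARD('n)" "0 \<le> s" "0 < s'"
    "?v = s *\<^sub>R vec_point p + s' *\<^sub>R vec_point q" "s * signature p + s' * signature q = 0"
    "index_chain u = (if s = 0 then {q} else {p, q})"
    and span: "\<And>(\<alpha> :: real) (\<beta> :: real). \<alpha> * signature p + \<beta> * signature q = 0 \<Longrightarrow>
      \<exists>t. \<alpha> *\<^sub>R vec_point p + \<beta> *\<^sub>R vec_point q = t *\<^sub>R ?v"
    by (rule vec_of_combination[OF assms]) blast
  have "?v $ j \<le> ?v $ i" if "i \<le> j" for i j
  proof -
    have "(vec_point p :: (real, 'n) vec) $ j \<le> (vec_point p :: (real, 'n) vec) $ i" for p
      using vec_point_weyl[of p, where 'n='n] that unfolding weyl_def by blast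
    then show ?thesis using *(4,5) by (simp add: *(6) add_mono mult_left_mono)
  qed
  moreover have "(\<Sum>i\<in>UNIV. ?v $ i) = s * signature p + s' * signature q"
    by (simp add: *(6) sum.distrib sum_vec_point *(2,3) flip: sum_distrib_left)
  ultimately show ?thesis using *(7) by (simp add: weyl_s_def weyl_def h_s_def)
qed

text \<open>
  This is why \<open>vec_of u\<close> spans an extreme ray: inside \<open>h_s\<close> the forms vanishing on it cut out just the
  line through it.
\<close>

lemma rigid_vec_of:
  fixes z :: "real ^ 'n::{finite,linorder}"
  assumes u: "u \<in> ray_index CARD('n)" and z: "z \<in> h_s"
    and van: "\<And>w. w \<in> forms \<Longrightarrow> w (vec_of u) = 0 \<Longrightarrow> w z = 0"
  shows "\<exists>t. z = t *\<^sub>R vec_of u"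
proof -
  let ?v = "vec_of u :: (real, 'n) vec"
  obtain p q and s s' :: real where *: "p \<le> q" "p \<in> estar CARD('n)" "q \<in> estar CARD('n)" "0 \<le> s" "0 < s'"
    "?v = s *\<^sub>R vec_point p + s' *\<^sub>R vec_point q" "s * signature p + s' * signature q = 0"
    "index_chain u = (if s = 0 then {q} else {p, q})"
    and span: "\<And>(\<alpha> :: real) (\<beta> :: real). \<alpha> * signature p + \<beta> * signature q = 0 \<Longrightarrow>
      \<exists>t. \<alpha> *\<^sub>R vec_point p + \<beta> *\<^sub>R vec_point q = t *\<^sub>R ?v"
    by (rule vec_of_combination[OF u]) blast
  obtain \<alpha> \<beta> where z_eq: "z = \<alpha> *\<^sub>R vec_point p + \<beta> *\<^sub>R vec_point q"
    using rigid_combination[OF *(1,3,4,5,6), of z] van by blast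
  have "(\<Sum>i\<in>UNIV. z $ i) = \<alpha> * signature p + \<beta> * signature q"
    by (simp add: z_eq sum.distrib sum_vec_point *(2,3) flip: sum_distrib_left)
  then have "\<alpha> * signature p + \<beta> * signature q = 0" using z by (simp add: h_s_def)
  then show ?thesis using span z_eq by simp
qed

section \<open>Extreme rays\<close>

lemma form_cone_scale: "a \<in> form_cone y \<Longrightarrow> 0 \<le> c \<Longrightarrow> c *\<^sub>R a \<in> form_cone y"
  by (auto simp: form_cone_def h_s_closed linear_forms linear_scale mult.left_commute)

text \<open>
  If both \<open>d\<close> and \<open>-d\<close> are weakly decreasing, \<open>d\<close> is constant, and its coordinates sum to zero.
\<close>

lemma form_cone_pointed:
  fixes d :: "real ^ 'n::{finite,linorder}"
  assumes y: "y \<in> regular_points" and d: "d \<in> form_cone y" "- d \<in> form_cone y"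
  shows "d = 0"
proof -
  have W: "d \<in> weyl" "- d \<in> weyl" and h: "d \<in> h_s"
    using form_cone_subset_weyl_s[OF y] d by (auto simp: weyl_s_def)
  have le: "d $ i = d $ j" if "i \<le> j" for i j
    using W that by (simp add: weyl_def antisym)
  have eq: "d $ i = d $ j" for i j
    using le linear[of i j] by metis
  have "d $ j = 0" for j
  proof -
    have "(\<Sum>i\<in>UNIV. d $ i) = (\<Sum>i\<in>(UNIV :: 'n set). d $ j)" by (rule sum.cong[OF refl eq])
    then show ?thesis using h by (simp add: h_s_def)
  qed
  then show ?thesis by (simp add: vec_eq_iff)
qed

text \<open>
  The sum \<open>a + b\<close> is the midpoint of \<open>2a\<close> and \<open>2b\<close>, which puts it into the form required by the
  definition of a face.
\<close>

lemma face_of_cone_splits: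
  assumes "F face_of form_cone y" "a \<in> form_cone y" "b \<in> form_cone y" "a + b \<in> F"
  shows "2 *\<^sub>R a \<in> F" "2 *\<^sub>R b \<in> F"
proof -
  have mid: "a + b = midpoint (2 *\<^sub>R a) (2 *\<^sub>R b)" by (simp add: midpoint_def scaleR_add_right)
  have "2 *\<^sub>R a \<in> F \<and> 2 *\<^sub>R b \<in> F"
  proof (cases "a = b")
    case True
    then show ?thesis using assms(4) by (simp add: scaleR_2)
  next
    case False
    then have "a + b \<in> open_segment (2 *\<^sub>R a) (2 *\<^sub>R b)" by (simp add: mid)
    then show ?thesis
      using face_ofD[OF assms(1) _ _ _ assms(4)] form_cone_scale assms(2,3) by (meson zero_le_numeral)
  qed
  then show "2 *\<^sub>R a \<in> F" "2 *\<^sub>R b \<in> F" by auto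
qed

text \<open>
  A face contains the apex 0 (split an element \<open>p\<close> as \<open>0 + p\<close>). So the half-line passes through 0; if
  it did not start there, it would contain two opposite directions, contradicting pointedness.
\<close>

lemma half_line_face_is_ray:
  fixes F :: "(real ^ 'n::{finite,linorder}) set"
  assumes y: "y \<in> regular_points" and F: "F face_of form_cone y" "half_line F"
  obtains d where "d \<noteq> 0" "d \<in> form_cone y" "F = ray_of d"
proof -
  obtain p d where d: "d \<noteq> 0" and F_eq: "F = {p + t *\<^sub>R d | t. t \<ge> 0}"
    using F(2) by (auto simp: half_line_def)
  have FC: "F \<subseteq> form_cone y" using F(1) by (rule face_of_imp_subset)
  have "p \<in> F" unfolding F_eq by (intro CollectI exI[of _ 0]) simp
  then have "p \<in> form_cone y" using FC by blast
  moreover have "0 \<in> form_cone y" using form_cone_scale[OF calculation, of 0] by simp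
  ultimately have "2 *\<^sub>R (0 :: (real, 'n) vec) \<in> F"
    using face_of_cone_splits(1)[OF F(1), of 0 p] \<open>p \<in> F\<close> by simp
  then obtain t where t: "t \<ge> 0" "p + t *\<^sub>R d = 0" by (auto simp: F_eq)
  have "d = p + (t + 1) *\<^sub>R d" using t(2) by (simp add: scaleR_add_left add.assoc[symmetric])
  then have "d \<in> F" unfolding F_eq using t(1) by (intro CollectI exI[of _ "t + 1"]) auto
  then have dC: "d \<in> form_cone y" using FC by blast
  have "t = 0"
  proof (rule ccontr)
    assume "t \<noteq> 0"
    moreover have "p = - (t *\<^sub>R d)" using t(2) by (simp add: eq_neg_iff_add_eq_0)
    ultimately have "- d = (1 / t) *\<^sub>R p" by simp
    then have "- d \<in> form_cone y" using form_cone_scale[OF \<open>p \<in> form_cone y\<close>, of "1 / t"] t(1) by simp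
    then show False using form_cone_pointed[OF y dC] d by simp
  qed
  then have "F = ray_of d" using t(2) by (simp add: F_eq ray_of_def)
  then show thesis using that d dC by blast
qed

lemma extreme_rays_eq:
  "extreme_rays = {ray_of d | d y. d \<noteq> (0 :: real ^ 'n::{finite,linorder}) \<and> y \<in> regular_points
     \<and> ray_of d face_of form_cone y}"
proof -
  have "half_line (ray_of d)" if "d \<noteq> 0" for d :: "(real, 'n) vec"
    unfolding half_line_def ray_of_def using that by (intro exI[of _ 0] exI[of _ d]) simp
  then show ?thesis
    unfolding extreme_rays_def arrangement_faces_def chambers_eq
    by (auto elim: half_line_face_is_ray) (metis half_line_face_is_ray)
qed

lemma ray_of_scale: "c > 0 \<Longrightarrow> ray_of (c *\<^sub>R v) = ray_of v"
proof (intro equalityI subsetI)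
  fix x assume c: "c > 0" and "x \<in> ray_of v"
  then obtain t where "t \<ge> 0" "x = t *\<^sub>R v" by (auto simp: ray_of_def)
  with c show "x \<in> ray_of (c *\<^sub>R v)" unfolding ray_of_def by (intro CollectI exI[of _ "t / c"]) simp
qed (auto simp: ray_of_def intro!: mult_nonneg_nonneg)

lemma self_in_ray_of: "v \<in> ray_of v"
  unfolding ray_of_def by (intro CollectI exI[of _ 1]) simp

text \<open>
  On the cone all products \<open>w y * w z\<close> are nonnegative. If \<open>w\<close> vanishes at a convex combination of two
  points of the cone, it therefore vanishes at both, and \<open>rigid_vec_of\<close> applies. Pointedness excludes
  negative multiples.
\<close>

lemma vec_of_spans_face:
  fixes y :: "real ^ 'n::{finite,linorder}"
  assumes u: "u \<in> ray_index CARD('n)" and y: "y \<in> regular_points"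
    and v: "vec_of u \<in> form_cone y"
  shows "ray_of (vec_of u) face_of form_cone y"
  unfolding face_of_def
proof (intro conjI ballI impI)
  let ?v = "vec_of u :: (real, 'n) vec"
  show "ray_of ?v \<subseteq> form_cone y" using form_cone_scale[OF v] by (auto simp: ray_of_def)
  show "convex (ray_of ?v)"
  proof (rule convexI)
    fix a b and r s :: real assume "a \<in> ray_of ?v" "b \<in> ray_of ?v" and rs: "0 \<le> r" "0 \<le> s"
    then obtain t t' where "a = t *\<^sub>R ?v" "b = t' *\<^sub>R ?v" "0 \<le> t" "0 \<le> t'" by (auto simp: ray_of_def)
    then have "r *\<^sub>R a + s *\<^sub>R b = (r * t + s * t') *\<^sub>R ?v" "0 \<le> r * t + s * t'"
      using rs by (simp_all add: scaleR_add_left)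
    then show "r *\<^sub>R a + s *\<^sub>R b \<in> ray_of ?v" unfolding ray_of_def by blast
  qed
  fix a b x
  assume a: "a \<in> form_cone y" and b: "b \<in> form_cone y" and x: "x \<in> ray_of ?v" "x \<in> open_segment a b"
  obtain r where r: "0 < r" "r < 1" "x = (1 - r) *\<^sub>R a + r *\<^sub>R b"
    using x(2) by (auto simp: in_segment)
  obtain t where t: "x = t *\<^sub>R ?v" using x(1) by (auto simp: ray_of_def)
  have van: "w a = 0 \<and> w b = 0" if w: "w \<in> forms" "w ?v = 0" for w
  proof (cases "w y = 0")
    case True
    then show ?thesis using regular_formD[OF y w(1)] a b by (auto simp: form_cone_def)
  next
    case False
    have "w x = (1 - r) * w a + r * w b"
      using linear_forms[OF w(1)] by (simp add: r(3) linear_add linear_scale)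
    moreover have "w x = t * w ?v"
      using linear_forms[OF w(1)] by (simp add: t linear_scale)
    ultimately have "w y * ((1 - r) * w a + r * w b) = 0" using w(2) by simp
    then have "(1 - r) * (w y * w a) + r * (w y * w b) = 0" by (simp add: algebra_simps)
    moreover have "0 \<le> (1 - r) * (w y * w a)" "0 \<le> r * (w y * w b)"
      using a b w(1) r by (auto simp: form_cone_def intro!: mult_nonneg_nonneg)
    ultimately have "(1 - r) * (w y * w a) = 0" "r * (w y * w b) = 0" by linarith+
    then show ?thesis using False r by simp
  qed
  have in_ray: "z \<in> ray_of ?v" if z: "z \<in> form_cone y"
    and van_z: "\<And>w. w \<in> forms \<Longrightarrow> w ?v = 0 \<Longrightarrow> w z = 0" for z
  proof -
    obtain c where c: "z = c *\<^sub>R ?v"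
      using rigid_vec_of[OF u, of z] van_z z by (auto simp: form_cone_def)
    have "0 \<le> c"
    proof (rule ccontr)
      assume "\<not> 0 \<le> c"
      then have "- ?v = (1 / - c) *\<^sub>R z" by (simp add: c)
      then have "- ?v \<in> form_cone y" using form_cone_scale[OF z, of "1 / - c"] \<open>\<not> 0 \<le> c\<close> by simp
      then show False using form_cone_pointed[OF y v] vec_of_nonzero[OF u] by simp
    qed
    then show ?thesis using c by (auto simp: ray_of_def)
  qed
  show "a \<in> ray_of ?v" "b \<in> ray_of ?v" using in_ray a b van by blast+
qed

text \<open>
  A null level gives a null point, and two levels of opposite signature give a balanced pair, the
  level at the larger threshold being the smaller point.
\<close>

lemma subordinate_vec_of:
  fixes d :: "real ^ 'n::{finite,linorder}"
  assumes d: "d \<in> weyl_s" "d \<noteq> 0"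
  obtains u where "u \<in> ray_index CARD('n)" "subordinate (vec_of u) d"
proof -
  have W: "d \<in> weyl" and h: "d \<in> h_s" using d(1) by (auto simp: weyl_s_def)
  from balanced_levels_exist[OF h d(2)] show thesis
  proof cases
    case (1 t)
    have "level d t \<in> null_points CARD('n)"
      using level_in_estar[OF 1(1,2)] 1(3) by (simp add: null_points_def)
    moreover have "subordinate (vec_of (Inl (level d t))) d"
      using subordinate_level[OF W 1(1)] by (simp add: vec_of_def)
    ultimately show thesis using that by blast
  next
    case (2 s t)
    let ?p = "level d t" and ?q = "level d s"
    have nz: "signature ?p \<noteq> 0" "signature ?q \<noteq> 0" "signature ?p \<noteq> signature ?q" using 2(3) by (auto simp: mult_less_0_iff)
    have "?p \<noteq> (0, 0)" "?q \<noteq> (0, 0)" using nz by (auto simp: signature_def)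
    then have "?p \<in> estar CARD('n)" "?q \<in> estar CARD('n)"
      using level_in_estar[of t d] level_in_estar[of s d] 2(1,2) by simp_all
    moreover have "?p < ?q"
      using level_antimono[of s t d] 2(2) nz(3) by (auto simp: less_le)
    ultimately have "(?p, ?q) \<in> balanced_pairs CARD('n)" using 2(3) by (simp add: balanced_pairs_def)
    moreover have "subordinate (vec_of (Inr (?p, ?q))) d"
      using subordinate_combination[OF subordinate_level[OF W] subordinate_level[OF W]] 2(1,2)
      by (simp add: vec_of_def vec_pair_def)
    ultimately show thesis using that by blast
  qed
qed

text \<open>
  Write \<open>d = (d - r e) + r e\<close> with \<open>e = vec_of u\<close> subordinate to \<open>d\<close>. Both summands lie in the cone, so
  \<open>e\<close> is on the ray of \<open>d\<close>.
\<close>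

lemma ray_face_eq_vec_of:
  fixes d :: "real ^ 'n::{finite,linorder}"
  assumes y: "y \<in> regular_points" and d: "d \<noteq> 0" and F: "ray_of d face_of form_cone y"
  obtains u where "u \<in> ray_index CARD('n)" "ray_of d = ray_of (vec_of u)"
proof -
  have dC: "d \<in> form_cone y" using face_of_imp_subset[OF F] self_in_ray_of by blast
  then have dW: "d \<in> weyl_s" using form_cone_subset_weyl_s[OF y] by blast
  obtain u where u: "u \<in> ray_index CARD('n)" "subordinate (vec_of u) d"
    using subordinate_vec_of[OF dW d] by blast
  let ?v = "vec_of u :: (real, 'n) vec"
  have "?v \<in> h_s" using vec_of_weyl_s[OF u(1)] by (simp add: weyl_s_def)
  note sub = subordinate_in_form_cone[OF dC this u(2)]
  obtain r where r: "r > 0" "d - r *\<^sub>R ?v \<in> form_cone y" using sub(2) by blast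
  have "2 *\<^sub>R r *\<^sub>R ?v \<in> ray_of d"
    by (rule face_of_cone_splits(2)[OF F r(2) form_cone_scale[OF sub(1)]]) (use r self_in_ray_of in auto)
  then obtain t where t: "t \<ge> 0" "(2 * r) *\<^sub>R ?v = t *\<^sub>R d" by (auto simp: ray_of_def)
  have "t \<noteq> 0" using t(2) r(1) vec_of_nonzero[OF u(1)] by auto
  then have "ray_of d = ray_of ?v"
    using ray_of_scale[of "2 * r" ?v] ray_of_scale[of t d] t r(1) by simp
  then show thesis using that u(1) by blast
qed

theorem theorem3p10:
  "bij_betw (\<lambda>u. ray_of (vec_of u :: real ^ 'n::{finite,linorder}))
     (null_points CARD('n) <+> balanced_pairs CARD('n))
     (extreme_rays :: (real ^ 'n::{finite,linorder}) set set)"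
  unfolding bij_betw_def
proof (intro conjI equalityI subsetI)
  show "inj_on (\<lambda>u. ray_of (vec_of u :: (real, 'n) vec)) (ray_index CARD('n))"
  proof (rule inj_onI)
    fix u u' assume u: "u \<in> ray_index CARD('n)" "u' \<in> ray_index CARD('n)"
      and eq: "ray_of (vec_of u :: (real, 'n) vec) = ray_of (vec_of u')"
    obtain c where c: "c \<ge> 0" "(vec_of u :: (real, 'n) vec) = c *\<^sub>R vec_of u'"
      using self_in_ray_of[of "vec_of u :: (real, 'n) vec"] unfolding eq by (auto simp: ray_of_def)
    then have "c > 0" using vec_of_nonzero[OF u(1)] by (cases "c = 0") auto
    then have "levels (vec_of u :: (real, 'n) vec) = levels (vec_of u' :: (real, 'n) vec)"
      by (simp add: c(2) levels_scale)
    then have "index_chain u = index_chain u'" using u by (simp add: levels_vec_of)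
    then show "u = u'" using inj_on_index_chain u by (auto dest: inj_onD)
  qed
next
  fix R assume "R \<in> (\<lambda>u. ray_of (vec_of u :: (real, 'n) vec)) ` ray_index CARD('n)"
  then obtain u where u: "u \<in> ray_index CARD('n)" and R: "R = ray_of (vec_of u :: (real, 'n) vec)"
    by blast
  obtain y where "y \<in> regular_points" "(vec_of u :: (real, 'n) vec) \<in> form_cone y"
    using exists_chamber_containing[OF vec_of_weyl_s[OF u]] by blast
  then show "R \<in> extreme_rays"
    using vec_of_spans_face[OF u] vec_of_nonzero[OF u] unfolding extreme_rays_eq R by blast
next
  fix R :: "(real, 'n) vec set" assume "R \<in> extreme_rays"
  then obtain d y where "R = ray_of d" "d \<noteq> 0" "y \<in> regular_points" "ray_of d face_of form_cone y"
    unfolding extreme_rays_eq by blast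
  then obtain u where "u \<in> ray_index CARD('n)" "R = ray_of (vec_of u :: (real, 'n) vec)"
    using ray_face_eq_vec_of by metis
  then show "R \<in> (\<lambda>u. ray_of (vec_of u :: (real, 'n) vec)) ` ray_index CARD('n)" by blast
qed

end
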